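(* Let $\gamma>0$ and $L>0$. Let $h:\mathbb{R}^n\to\mathbb{R}$ be a strongly quasiconvex function with modulus $\gamma$ which is differentiable with $L$-Lipschitz continuous gradient, and let $\overline{x}$ be the minimizer of $h$ on $\mathbb{R}^n$, i.e. $\{\overline{x}\}=\operatorname{argmin}_{\mathbb{R}^n}h$. Then the Polyak-Łojasiewicz property holds with modulus $\mu:=\frac{\gamma^2}{2L}>0$, that is, $$\|\nabla h(x)\|^2\ge\frac{\gamma^2}{2L}\,\bigl(h(x)-h(\overline{x})\bigr)\quad\text{for all }x\in\mathbb{R}^n.$$
   Context: $\|\cdot\|$ is the Euclidean norm on $\mathbb{R}^n$. A function $h:\mathbb{R}^n\to\mathbb{R}$ is strongly quasiconvex with modulus $\gamma>0$ if for all $x,y\in\mathbb{R}^n$ and all $\lambda\in[0,1]$, $$h(\lambda y+(1-\lambda)x)\le\max\{h(y),h(x)\}-\lambda(1-\lambda)\frac{\gamma}{2}\|x-y\|^2.$$ It is known that a lower semicontinuous strongly quasiconvex function on $\mathbb{R}^n$ has exactly one minimizer. The gradient is $L$-Lipschitz continuous if $\|\nabla h(x)-\nabla h(y)\|\le L\|x-y\|$ for all $x,y\in\mathbb{R}^n$. *)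

theory Defs
  imports "HOL-Analysis.Analysis"
begin

definition strongly_quasiconvex :: "real \<Rightarrow> ('a::real_normed_vector \<Rightarrow> real) \<Rightarrow> bool" where
  "strongly_quasiconvex \<gamma> h \<longleftrightarrow>
    (\<forall>x y. \<forall>t\<in>{0..1}.
      h (t *\<^sub>R y + (1 - t) *\<^sub>R x) \<le> max (h y) (h x) - t * (1 - t) * (\<gamma> / 2) * (norm (x - y))\<^sup>2)"

end

theory Submission
  imports Defs
begin

text \<open>
  Differentiating the quasiconvexity inequality at the start of the segment from \<open>x\<close> to the
  minimizer \<open>xbar\<close> and applying Cauchy-Schwarz gives
  \<open>\<gamma> / 2 * \<parallel>x - xbar\<parallel> \<le> \<parallel>\<nabla>h x\<parallel>\<close>. The gradient vanishes at \<open>xbar\<close>, so the descent lemma gives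
  \<open>h x - h xbar \<le> L / 2 * \<parallel>x - xbar\<parallel>\<^sup>2\<close>. Combine the two estimates.
\<close>

lemma GDERIV_line:
  fixes f :: "'a::real_inner \<Rightarrow> real"
  assumes "GDERIV f (a + t *\<^sub>R d) :> D"
  shows "((\<lambda>s. f (a + s *\<^sub>R d)) has_real_derivative (D \<bullet> d)) (at t)"
proof -
  have "((\<lambda>s. a + s *\<^sub>R d) has_derivative (\<lambda>s. s *\<^sub>R d)) (at t)"
    by (auto intro!: derivative_eq_intros)
  then have "((\<lambda>s. f (a + s *\<^sub>R d)) has_derivative (\<lambda>s. (s *\<^sub>R d) \<bullet> D)) (at t)"
    using assms unfolding gderiv_def by (rule has_derivative_compose)
  then show ?thesis
    unfolding has_field_derivative_def
    by (rule has_derivative_eq_rhs) (auto simp: inner_commute mult.commute)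
qed

lemma GDERIV_zero_at_minimum:
  fixes f :: "'a::real_inner \<Rightarrow> real"
  assumes "GDERIV f a :> D" and "\<And>x. f a \<le> f x"
  shows "D = 0"
proof -
  \<comment> \<open>The direction of travel is the gradient itself, so the slope that vanishes at
    the minimum is the squared norm of \<open>D\<close>.\<close>
  have "((\<lambda>s. f (a + s *\<^sub>R D)) has_real_derivative (D \<bullet> D)) (at 0)"
    using assms(1) by (intro GDERIV_line) simp
  then have "D \<bullet> D = 0"
    by (rule DERIV_local_min[where d = 1]) (use assms(2) in auto)
  then show ?thesis by simp
qed

text \<open>Along the segment from \<open>x\<close> to \<open>y\<close>, \<open>\<psi>\<close> is
  \<open>f\<close> minus its quadratic upper model (up to the constant \<open>f x\<close>).
  Cauchy-Schwarz and the Lipschitz bound make its derivative nonpositive, and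
  \<open>\<psi> 1 \<le> \<psi> 0\<close> is the claim.\<close>

lemma lipschitz_gradient_descent:
  fixes f :: "'a::real_inner \<Rightarrow> real"
  assumes grad: "\<And>x. GDERIV f x :> g x" and lip: "L-lipschitz_on UNIV g"
  shows "f y \<le> f x + g x \<bullet> (y - x) + L / 2 * (norm (y - x))\<^sup>2"
proof -
  define d where "d = y - x"
  define \<psi> where "\<psi> s = f (x + s *\<^sub>R d) - s * (g x \<bullet> d) - L / 2 * s\<^sup>2 * (norm d)\<^sup>2" for s
  have "\<psi> 1 \<le> \<psi> 0"
  proof (rule DERIV_nonpos_imp_nonincreasing[where f = \<psi>])
    fix t :: real assume t: "0 \<le> t" "t \<le> 1"
    have "(\<psi> has_real_derivative
        (g (x + t *\<^sub>R d) \<bullet> d - g x \<bullet> d - L * t * (norm d)\<^sup>2)) (at t)"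
      unfolding \<psi>_def by (auto intro!: derivative_eq_intros GDERIV_line grad)
    moreover have "g (x + t *\<^sub>R d) \<bullet> d - g x \<bullet> d \<le> L * t * (norm d)\<^sup>2"
    proof -
      have "(g (x + t *\<^sub>R d) - g x) \<bullet> d \<le> norm (g (x + t *\<^sub>R d) - g x) * norm d"
        by (rule norm_cauchy_schwarz)
      also have "\<dots> \<le> (L * norm (t *\<^sub>R d)) * norm d"
        using lipschitz_onD[OF lip, of "x + t *\<^sub>R d" x]
        by (intro mult_right_mono) (auto simp: dist_norm)
      finally show ?thesis
        using t by (simp add: inner_diff_left power2_eq_square mult_ac)
    qed
    ultimately show "\<exists>z. (\<psi> has_real_derivative z) (at t) \<and> z \<le> 0"
      by (intro exI conjI) (assumption, simp)
  qed simp
  then show ?thesis by (simp add: \<psi>_def d_def)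
qed

text \<open>Since \<open>f y \<le> f x\<close>, strong quasiconvexity bounds \<open>\<psi>\<close>
  by \<open>f x = \<psi> 0\<close> on the whole segment. If the claim failed, \<open>\<psi>\<close>
  would have positive slope at 0 and rise above that value at once.\<close>

lemma strongly_quasiconvex_gradient:
  fixes f :: "'a::real_inner \<Rightarrow> real"
  assumes sqc: "strongly_quasiconvex \<gamma> f" and grad: "GDERIV f x :> D" and le: "f y \<le> f x"
  shows "\<gamma> / 2 * (norm (x - y))\<^sup>2 \<le> D \<bullet> (x - y)"
proof (rule ccontr)
  define d where "d = y - x"
  define \<psi> where "\<psi> s = f (x + s *\<^sub>R d) + s * (1 - s) * (\<gamma> / 2) * (norm (x - y))\<^sup>2" for s
  assume "\<not> ?thesis"
  then have pos: "0 < D \<bullet> d + \<gamma> / 2 * (norm (x - y))\<^sup>2"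
    by (simp add: d_def inner_diff_right)
  have "((\<lambda>s. f (x + s *\<^sub>R d)) has_real_derivative (D \<bullet> d)) (at 0)"
    using grad by (intro GDERIV_line) simp
  \<comment> \<open>The factor \<open>s * (1 - s)\<close> has derivative 1 at 0, so the quadratic
    term enters the slope with its full coefficient \<open>\<gamma> / 2\<close>.\<close>
  then have "(\<psi> has_real_derivative (D \<bullet> d + \<gamma> / 2 * (norm (x - y))\<^sup>2)) (at 0)"
    unfolding \<psi>_def by (auto intro!: derivative_eq_intros)
  from DERIV_pos_inc_right[OF this pos]
  obtain \<delta> where "\<delta> > 0" and inc: "\<And>s. 0 < s \<Longrightarrow> s < \<delta> \<Longrightarrow> \<psi> 0 < \<psi> s"
    by auto
  \<comment> \<open>Halving gives \<open>s < \<delta>\<close>; the cap at 1 keeps \<open>s\<close>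
    in the range where the quasiconvexity inequality is available.\<close>
  define s where "s = min 1 (\<delta> / 2)"
  have s: "0 < s" "s < \<delta>" "s \<le> 1"
    using \<open>\<delta> > 0\<close> by (auto simp: s_def)
  have "x + s *\<^sub>R d = s *\<^sub>R y + (1 - s) *\<^sub>R x"
    by (simp add: d_def algebra_simps)
  then have "\<psi> s \<le> f x"
    using sqc[unfolded strongly_quasiconvex_def, rule_format, of s y x] s le
    by (simp add: \<psi>_def max_def split: if_splits)
  with inc[OF s(1,2)] show False by (simp add: \<psi>_def)
qed

theorem proposition7:
  fixes h :: "real ^ 'n \<Rightarrow> real"
    and grad_h :: "real ^ 'n \<Rightarrow> real ^ 'n"
    and \<gamma> L :: real
    and xbar :: "real ^ 'n"
  assumes "\<gamma> > 0" and "L > 0"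
    and "strongly_quasiconvex \<gamma> h"
    and "\<And>x. GDERIV h x :> grad_h x"
    and "L-lipschitz_on UNIV grad_h"
    and "{x. is_arg_min h (\<lambda>y. y \<in> UNIV) x} = {xbar}"
  shows "\<gamma>\<^sup>2 / (2 * L) > 0 \<and>
    (\<forall>x. (norm (grad_h x))\<^sup>2 \<ge> \<gamma>\<^sup>2 / (2 * L) * (h x - h xbar))"
proof (intro conjI allI)
  show "\<gamma>\<^sup>2 / (2 * L) > 0" using assms(1,2) by simp
  have "is_arg_min h (\<lambda>y. y \<in> UNIV) xbar" using assms(6) by blast
  then have min: "h xbar \<le> h x" for x
    by (auto simp: is_arg_min_def not_less)
  then have grad0: "grad_h xbar = 0"
    using GDERIV_zero_at_minimum[OF assms(4)] by blast
  fix x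
  define r where "r = norm (x - xbar)"
  have "h x - h xbar \<le> L / 2 * r\<^sup>2"
    using lipschitz_gradient_descent[OF assms(4,5), of x xbar] by (simp add: grad0 r_def)
  then have "\<gamma>\<^sup>2 / (2 * L) * (h x - h xbar) \<le> \<gamma>\<^sup>2 / (2 * L) * (L / 2 * r\<^sup>2)"
    using assms(1,2) by (intro mult_left_mono) auto
  \<comment> \<open>The \<open>L\<close> of the modulus cancels against the \<open>L / 2\<close> of
    the descent lemma, leaving the perfect square
    \<open>(\<gamma> / 2)\<^sup>2 * r\<^sup>2\<close>.\<close>
  also have "\<dots> = (\<gamma> / 2 * r)\<^sup>2"
    using assms(2) by (simp add: power2_eq_square field_simps)
  also have "\<dots> \<le> (norm (grad_h x))\<^sup>2"
  proof (rule power_mono)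
    have "\<gamma> / 2 * r\<^sup>2 \<le> grad_h x \<bullet> (x - xbar)"
      unfolding r_def by (rule strongly_quasiconvex_gradient[OF assms(3,4) min])
    also have "\<dots> \<le> norm (grad_h x) * r"
      unfolding r_def by (rule norm_cauchy_schwarz)
    finally have "(\<gamma> / 2 * r) * r \<le> norm (grad_h x) * r"
      by (simp add: power2_eq_square)
    \<comment> \<open>Cancelling \<open>r\<close> requires \<open>r > 0\<close>; at
      \<open>r = 0\<close> the left side is 0 and the bound is trivial.\<close>
    then show "\<gamma> / 2 * r \<le> norm (grad_h x)"
      by (cases "r = 0") (auto simp: r_def)
    show "0 \<le> \<gamma> / 2 * r" using assms(1) by (simp add: r_def)
  qed
  finally show "\<gamma>\<^sup>2 / (2 * L) * (h x - h xbar) \<le> (norm (grad_h x))\<^sup>2" .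
qed

end
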